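(* Complete graphs are determined by the Smith normal form of the distance Laplacian matrix: if $G$ is a connected graph whose distance Laplacian matrix $F(G)$ has the same Smith normal form over $\mathbb{Z}$ as the distance Laplacian matrix $F(K_n)$ of a complete graph $K_n$, then $G$ is isomorphic to $K_n$.
   Context: Graphs are simple, finite and connected. $K_n$ is the complete graph on $n$ vertices. The distance Laplacian matrix of $G$ is $F(G)=T(G)-D(G)$, where $D(G)$ is the distance matrix (entry $(u,v)$ is the graph distance between $u$ and $v$) and $T(G)$ is the diagonal matrix of transmissions, the transmission of a vertex being the sum of its distances to all other vertices. The Smith normal form of an integer matrix is the unique equivalent (over $\mathbb{Z}$) diagonal matrix $\operatorname{diag}(f_1,\dots,f_r,0,\dots,0)$ with positive integers $f_1\mid f_2\mid\cdots\mid f_r$; two matrices having the same Smith normal form in particular have the same size. *)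

theory Defs
  imports "Graph_Theory.Graph_Theory" "Jordan_Normal_Form.Matrix"
begin

text \<open>
  Finite simple graphs are the symmetric digraphs without loops and parallel arcs of the
  locale \<^locale>\<open>graph\<close>; every edge is a pair of opposite arcs, so the length of an arc walk
  is its number of edges.
\<close>

definition graph_dist :: "('a,'b) pre_digraph \<Rightarrow> 'a \<Rightarrow> 'a \<Rightarrow> nat" where
  "graph_dist G u v = (LEAST k. \<exists>p. pre_digraph.awalk G u p v \<and> length p = k)"

text \<open>
  On reachable pairs this is the library's shortest path distance with unit weights, which
  takes extended real values.
\<close>

lemma (in wf_digraph) \<mu>_unit_weight:
  assumes "u \<rightarrow>\<^sup>* v"
  shows "\<mu> (\<lambda>_. 1) u v = ereal (real (graph_dist G u v))"
proof -
  have cost: "awalk_cost (\<lambda>_. 1) p = real (length p)" for p :: "'b list"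
    by (induction p) auto
  have ex: "\<exists>k p. awalk u p v \<and> length p = k"
    using assms by (auto simp: reachable_awalk)
  obtain p where p: "awalk u p v" "length p = graph_dist G u v"
    using LeastI_ex[OF ex] unfolding graph_dist_def by blast
  have le: "graph_dist G u v \<le> length q" if "awalk u q v" for q
    unfolding graph_dist_def using that by (intro Least_le) blast
  show ?thesis
    unfolding \<mu>_def cost
  proof (rule antisym)
    show "(INF q\<in>{q. awalk u q v}. ereal (real (length q))) \<le> ereal (real (graph_dist G u v))"
      using p by (intro INF_lower2[of p]) auto
    show "ereal (real (graph_dist G u v)) \<le> (INF q\<in>{q. awalk u q v}. ereal (real (length q)))"
      using le by (intro INF_greatest) auto
  qed
qed

definition transmission :: "('a,'b) pre_digraph \<Rightarrow> 'a \<Rightarrow> nat" where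
  "transmission G u = (\<Sum>v\<in>verts G - {u}. graph_dist G u v)"

text \<open>
  Matrices attached to a graph are indexed by positions in a list enumerating its vertices.
  Another enumeration conjugates them by a permutation matrix.
\<close>

definition vertex_enumeration :: "('a,'b) pre_digraph \<Rightarrow> 'a list \<Rightarrow> bool" where
  "vertex_enumeration G vs \<longleftrightarrow> distinct vs \<and> set vs = verts G"

definition distance_mat :: "('a,'b) pre_digraph \<Rightarrow> 'a list \<Rightarrow> int mat" where
  "distance_mat G vs =
     mat (length vs) (length vs) (\<lambda>(i,j). int (graph_dist G (vs ! i) (vs ! j)))"

definition transmission_mat :: "('a,'b) pre_digraph \<Rightarrow> 'a list \<Rightarrow> int mat" where
  "transmission_mat G vs =
     mat (length vs) (length vs) (\<lambda>(i,j). if i = j then int (transmission G (vs ! i)) else 0)"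

definition distance_laplacian_mat :: "('a,'b) pre_digraph \<Rightarrow> 'a list \<Rightarrow> int mat" where
  "distance_laplacian_mat G vs = transmission_mat G vs - distance_mat G vs"

definition in_smith_normal_form :: "int mat \<Rightarrow> bool" where
  "in_smith_normal_form S \<longleftrightarrow> diagonal_mat S \<and>
     (\<exists>r \<le> min (dim_row S) (dim_col S).
        (\<forall>i<r. 0 < S $$ (i,i)) \<and>
        (\<forall>i. Suc i < r \<longrightarrow> S $$ (i,i) dvd S $$ (Suc i, Suc i)) \<and>
        (\<forall>i. r \<le> i \<and> i < min (dim_row S) (dim_col S) \<longrightarrow> S $$ (i,i) = 0))"

text \<open>
  For integer matrices, \<^const>\<open>invertible_mat\<close> asks for an integer inverse.
\<close>

definition equivalent_mat :: "int mat \<Rightarrow> int mat \<Rightarrow> bool" where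
  "equivalent_mat A B \<longleftrightarrow>
     (\<exists>P \<in> carrier_mat (dim_row A) (dim_row A). \<exists>Q \<in> carrier_mat (dim_col A) (dim_col A).
        invertible_mat P \<and> invertible_mat Q \<and> B = P * A * Q)"

definition is_smith_normal_form_of :: "int mat \<Rightarrow> int mat \<Rightarrow> bool" where
  "is_smith_normal_form_of S A \<longleftrightarrow> in_smith_normal_form S \<and> equivalent_mat A S"

definition same_smith_normal_form :: "int mat \<Rightarrow> int mat \<Rightarrow> bool" where
  "same_smith_normal_form A B \<longleftrightarrow>
     (\<exists>S. is_smith_normal_form_of S A \<and> is_smith_normal_form_of S B)"

end

theory Submission
  imports Defs "HOL-Number_Theory.Cong"
begin

text \<open>
  Modulo \<open>n\<close> the matrix \<open>F(K\<^sub>n) = n I - J\<close> is \<open>- J\<close>, a column times a row. Multiplying by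
  integer matrices keeps this shape, and a common Smith normal form gives
  \<open>F(G) = P F(K\<^sub>n) Q\<close> with integer \<open>P\<close> and \<open>Q\<close>. Hence \<open>G\<close> has \<open>n\<close> vertices and all
  \<open>2 \<times> 2\<close> minors of \<open>F(G)\<close> vanish modulo \<open>n\<close>. This consequence of the hypothesis
  already forces \<open>G\<close> to be complete.

  If \<open>x\<close> and \<open>y\<close> are both adjacent to \<open>z\<close>, then row \<open>z\<close> has the entry \<open>- 1\<close> in the columns
  \<open>x\<close> and \<open>y\<close>, and the minors that use row \<open>z\<close> say that these two columns are congruent
  (lemma \<open>columns_of_neighbours_cong\<close>). Suppose that \<open>G\<close> is connected but not complete. It has
  a path \<open>u, v, w\<close> with \<open>u\<close> and \<open>w\<close> distinct and not adjacent. Going along walks from \<open>u\<close>,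
  every column is congruent to that of \<open>u\<close>, hence to that of \<open>w\<close>, or to that of \<open>v\<close>
  (lemma \<open>two_column_classes\<close>). So every entry of row \<open>u\<close>, the diagonal one included, is
  congruent to \<open>F\<^sub>u\<^sub>w = - 2\<close> or to \<open>F\<^sub>u\<^sub>v = - 1\<close>. If \<open>k\<close> of the \<open>n\<close> entries are congruent
  to \<open>- 2\<close>, then the row sum, which is \<open>0\<close>, is congruent to \<open>- n - k\<close>. So \<open>n\<close> divides \<open>k\<close>,
  and \<open>k\<close> is \<open>0\<close> or \<open>n\<close>. But column \<open>w\<close> is counted by \<open>k\<close>, and column \<open>v\<close> is not, as
  \<open>- 1\<close> and \<open>- 2\<close> are not congruent modulo \<open>n > 1\<close>.
\<close>

section \<open>Integer matrices of rank one modulo an integer\<close>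

text \<open>
  The predicate asks for a factorization and not for vanishing minors: the two conditions
  can differ for a composite modulus, and a factorization passes to matrix products at once.
  The zero matrix is included.
\<close>

definition rank_one_mod :: "int \<Rightarrow> int mat \<Rightarrow> bool" where
  "rank_one_mod m A \<longleftrightarrow>
     (\<exists>a b. \<forall>i<dim_row A. \<forall>j<dim_col A. [A $$ (i,j) = a i * b j] (mod m))"

lemma rank_one_mod_mult_left:
  assumes "rank_one_mod m A" and "dim_col P = dim_row A"
  shows "rank_one_mod m (P * A)"
proof -
  obtain a b where ab: "\<And>i j. i < dim_row A \<Longrightarrow> j < dim_col A \<Longrightarrow> [A $$ (i,j) = a i * b j] (mod m)"
    using assms(1) unfolding rank_one_mod_def by blast
  have "[(P * A) $$ (i,j) = (\<Sum>k<dim_row A. P $$ (i,k) * a k) * b j] (mod m)"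
    if "i < dim_row P" "j < dim_col A" for i j
  proof -
    have "(P * A) $$ (i,j) = (\<Sum>k<dim_row A. P $$ (i,k) * A $$ (k,j))"
      using that assms(2) by (simp add: scalar_prod_def atLeast0LessThan)
    also have "[\<dots> = (\<Sum>k<dim_row A. P $$ (i,k) * (a k * b j))] (mod m)"
      using that ab by (intro cong_sum cong_mult) auto
    finally show ?thesis
      by (simp add: sum_distrib_right mult.assoc)
  qed
  then show ?thesis
    unfolding rank_one_mod_def index_mult_mat(2,3)
    by (intro exI[of _ "\<lambda>i. \<Sum>k<dim_row A. P $$ (i,k) * a k"] exI[of _ b]) simp
qed

lemma rank_one_mod_mult_right:
  assumes "rank_one_mod m A" and "dim_row Q = dim_col A"
  shows "rank_one_mod m (A * Q)"
proof -
  obtain a b where ab: "\<And>i j. i < dim_row A \<Longrightarrow> j < dim_col A \<Longrightarrow> [A $$ (i,j) = a i * b j] (mod m)"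
    using assms(1) unfolding rank_one_mod_def by blast
  have "[(A * Q) $$ (i,j) = a i * (\<Sum>k<dim_col A. b k * Q $$ (k,j))] (mod m)"
    if "i < dim_row A" "j < dim_col Q" for i j
  proof -
    have "(A * Q) $$ (i,j) = (\<Sum>k<dim_col A. A $$ (i,k) * Q $$ (k,j))"
      using that assms(2) by (simp add: scalar_prod_def atLeast0LessThan)
    also have "[\<dots> = (\<Sum>k<dim_col A. (a i * b k) * Q $$ (k,j))] (mod m)"
      using that ab by (intro cong_sum cong_mult) auto
    finally show ?thesis
      by (simp add: sum_distrib_left mult.assoc)
  qed
  then show ?thesis
    unfolding rank_one_mod_def index_mult_mat(2,3)
    by (intro exI[of _ a] exI[of _ "\<lambda>j. \<Sum>k<dim_col A. b k * Q $$ (k,j)"]) simp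
qed

lemma rank_one_mod_minor:
  assumes "rank_one_mod m A" "i < dim_row A" "k < dim_row A" "j < dim_col A" "l < dim_col A"
  shows "[A $$ (i,j) * A $$ (k,l) = A $$ (i,l) * A $$ (k,j)] (mod m)"
proof -
  obtain a b where ab: "\<And>i j. i < dim_row A \<Longrightarrow> j < dim_col A \<Longrightarrow> [A $$ (i,j) = a i * b j] (mod m)"
    using assms(1) unfolding rank_one_mod_def by blast
  have "[A $$ (i,j) * A $$ (k,l) = (a i * b j) * (a k * b l)] (mod m)"
    using assms by (intro cong_mult ab)
  also have "(a i * b j) * (a k * b l) = (a i * b l) * (a k * b j)"
    by simp
  also have "[\<dots> = A $$ (i,l) * A $$ (k,j)] (mod m)"
    using assms by (intro cong_mult cong_sym[OF ab])
  finally show ?thesis .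
qed

lemma invertible_mat_inverse:
  fixes P :: "int mat"
  assumes "invertible_mat P" "P \<in> carrier_mat n n"
  obtains P' where "P' \<in> carrier_mat n n" "P' * P = 1\<^sub>m n" "P * P' = 1\<^sub>m n"
proof -
  obtain P' where P': "P * P' = 1\<^sub>m (dim_row P)" "P' * P = 1\<^sub>m (dim_row P')"
    using assms(1) unfolding invertible_mat_def inverts_mat_def by blast
  have "dim_col P' = n" "dim_row P' = n"
    using arg_cong[OF P'(1), of dim_col] arg_cong[OF P'(2), of dim_col] assms(2) by auto
  then show ?thesis
    using that[of P'] P' assms(2) by auto
qed

text \<open>
  Both matrices are equivalent to the same Smith normal form; inverting the two multipliers
  on the side of \<open>A\<close> moves them to the side of \<open>B\<close>.
\<close>

lemma same_smith_normal_form_imp_factorization: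
  assumes "same_smith_normal_form A B"
  obtains P Q where "P \<in> carrier_mat (dim_row B) (dim_row B)"
    "Q \<in> carrier_mat (dim_col B) (dim_col B)" "A = P * B * Q"
proof -
  obtain S where "equivalent_mat A S" "equivalent_mat B S"
    using assms unfolding same_smith_normal_form_def is_smith_normal_form_of_def by blast
  then obtain P1 Q1 P2 Q2
    where 1: "P1 \<in> carrier_mat (dim_row A) (dim_row A)" "Q1 \<in> carrier_mat (dim_col A) (dim_col A)"
        "invertible_mat P1" "invertible_mat Q1" "S = P1 * A * Q1"
      and 2: "P2 \<in> carrier_mat (dim_row B) (dim_row B)" "Q2 \<in> carrier_mat (dim_col B) (dim_col B)"
        "S = P2 * B * Q2"
    unfolding equivalent_mat_def by metis
  define r where "r = dim_row B"
  define c where "c = dim_col B"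
  have "dim_row A = r" "dim_col A = c"
    using 1 2 unfolding r_def c_def by (metis carrier_matD index_mult_mat(2,3))+
  then have A: "A \<in> carrier_mat r c" and B: "B \<in> carrier_mat r c"
    and P1: "P1 \<in> carrier_mat r r" and Q1: "Q1 \<in> carrier_mat c c"
    and P2: "P2 \<in> carrier_mat r r" and Q2: "Q2 \<in> carrier_mat c c"
    using 1 2 unfolding r_def c_def by auto
  obtain P' where P': "P' \<in> carrier_mat r r" "P' * P1 = 1\<^sub>m r"
    using invertible_mat_inverse[OF 1(3) P1] by blast
  obtain Q' where Q': "Q' \<in> carrier_mat c c" "Q1 * Q' = 1\<^sub>m c"
    using invertible_mat_inverse[OF 1(4) Q1] by blast
  have "(P' * P2) * B * (Q2 * Q') = P' * (P2 * B * Q2) * Q'"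
    using P'(1) P2 B Q2 Q'(1) by (simp add: assoc_mult_mat[of _ r r _ r _ c] assoc_mult_mat[of _ r r _ c _ c] assoc_mult_mat[of _ r c _ c _ c])
  also have "\<dots> = P' * (P1 * A * Q1) * Q'"
    using 1(5) 2(3) by simp
  also have "\<dots> = (P' * P1) * A * (Q1 * Q')"
    using P'(1) P1 A Q1 Q'(1) by (simp add: assoc_mult_mat[of _ r r _ r _ c] assoc_mult_mat[of _ r r _ c _ c] assoc_mult_mat[of _ r c _ c _ c])
  also have "\<dots> = A"
    using P'(2) Q'(2) A by simp
  finally have "A = (P' * P2) * B * (Q2 * Q')" ..
  then show ?thesis
    using that[of "P' * P2" "Q2 * Q'"] P'(1) P2 Q2 Q'(1) unfolding r_def c_def by auto
qed

section \<open>Entries of the distance Laplacian\<close>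

definition distance_laplacian :: "('a,'b) pre_digraph \<Rightarrow> 'a \<Rightarrow> 'a \<Rightarrow> int" where
  "distance_laplacian G u v =
     (if u = v then int (transmission G u) else - int (graph_dist G u v))"

lemma (in wf_digraph) graph_dist_self: "u \<in> verts G \<Longrightarrow> graph_dist G u u = 0"
  unfolding graph_dist_def by (intro Least_equality) (auto simp: awalk_Nil_iff)

lemma (in wf_digraph) graph_dist_adjacent:
  assumes "u \<rightarrow> v" "u \<noteq> v"
  shows "graph_dist G u v = 1"
  unfolding graph_dist_def
proof (rule Least_equality)
  obtain e where "e \<in> arcs G" "tail G e = u" "head G e = v"
    using assms(1) by blast
  then show "\<exists>p. awalk u p v \<and> length p = 1"
    by (intro exI[of _ "[e]"]) (auto simp: awalk_simps)
  show "1 \<le> k" if "\<exists>p. awalk u p v \<and> length p = k" for k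
    using that assms(2) by (cases k) (auto simp: awalk_simps)
qed

lemma (in wf_digraph) graph_dist_two:
  assumes "u \<rightarrow> v" "v \<rightarrow> w" "u \<noteq> w" "\<not> u \<rightarrow> w"
  shows "graph_dist G u w = 2"
  unfolding graph_dist_def
proof (rule Least_equality)
  obtain e f where "e \<in> arcs G" "tail G e = u" "head G e = v"
    "f \<in> arcs G" "tail G f = v" "head G f = w"
    using assms(1,2) by (meson reachableE)
  then show "\<exists>p. awalk u p w \<and> length p = 2"
    by (intro exI[of _ "[e,f]"]) (auto simp: awalk_simps)
  show "2 \<le> k" if "\<exists>p. awalk u p w \<and> length p = k" for k
  proof (rule ccontr)
    assume "\<not> 2 \<le> k"
    then consider "k = 0" | "k = 1" by linarith
    then show False
    proof cases
      case 1
      then show False using that assms(3) by (auto simp: awalk_simps)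
    next
      case 2
      with that obtain e where "awalk u [e] w"
        by (auto simp: length_Suc_conv)
      then have "u \<rightarrow> w"
        by (auto simp: awalk_simps intro: in_arcs_imp_in_arcs_ends)
      with assms(4) show False ..
    qed
  qed
qed

lemma distance_laplacian_row_sum:
  assumes "finite (verts G)" "u \<in> verts G"
  shows "(\<Sum>v\<in>verts G. distance_laplacian G u v) = 0"
proof -
  have "(\<Sum>v\<in>verts G - {u}. distance_laplacian G u v) = - int (transmission G u)"
    unfolding transmission_def of_nat_sum sum_negf[symmetric]
    by (intro sum.cong) (auto simp: distance_laplacian_def)
  then show ?thesis
    using sum.remove[OF assms, of "distance_laplacian G u"] by (simp add: distance_laplacian_def)
qed

lemma (in wf_digraph) distance_laplacian_mat_index:
  assumes "vertex_enumeration G vs" "i < length vs" "j < length vs"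
  shows "distance_laplacian_mat G vs $$ (i,j) = distance_laplacian G (vs ! i) (vs ! j)"
proof -
  have "distinct vs" "set vs = verts G"
    using assms(1) by (simp_all add: vertex_enumeration_def)
  then have "vs ! i \<in> verts G" and eq: "vs ! i = vs ! j \<longleftrightarrow> i = j"
    using nth_mem[OF assms(2)] nth_eq_iff_index_eq[OF _ assms(2,3)] by blast+
  have "graph_dist G (vs ! i) (vs ! i) = 0"
    using \<open>vs ! i \<in> verts G\<close> by (rule graph_dist_self)
  then show ?thesis
    using assms(2,3) eq
    by (cases "i = j")
      (simp_all add: distance_laplacian_mat_def transmission_mat_def distance_mat_def
        distance_laplacian_def)
qed

lemma dim_distance_laplacian_mat [simp]:
  "dim_row (distance_laplacian_mat G vs) = length vs"
  "dim_col (distance_laplacian_mat G vs) = length vs"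
  by (simp_all add: distance_laplacian_mat_def transmission_mat_def distance_mat_def)

section \<open>Complete graphs\<close>

text \<open>
  The transmission of every vertex is \<open>n - 1\<close>, which is congruent to the off-diagonal entry
  \<open>- 1\<close>.
\<close>

lemma complete_digraph_rank_one_mod:
  assumes K: "complete_digraph n K" and ws: "vertex_enumeration K ws"
  shows "rank_one_mod (int n) (distance_laplacian_mat K ws)"
proof -
  interpret graph K using K by (simp add: complete_digraph_def)
  have dist: "graph_dist K u v = 1" if "u \<in> verts K" "v \<in> verts K" "u \<noteq> v" for u v
    using K that by (intro graph_dist_adjacent) (auto simp: complete_digraph_def)
  have diag: "int (transmission K u) = int n - 1" if "u \<in> verts K" for u
  proof -
    have "transmission K u = (\<Sum>v\<in>verts K - {u}. 1)"
      unfolding transmission_def using dist that by (intro sum.cong) auto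
    then have "transmission K u = card (verts K - {u})"
      by simp
    moreover have "Suc (card (verts K - {u})) = n"
      using K that card_Suc_Diff1[OF finite_verts that] by (simp add: complete_digraph_def)
    ultimately show ?thesis by linarith
  qed
  have "[distance_laplacian K u v = - 1 * 1] (mod int n)" if "u \<in> verts K" "v \<in> verts K" for u v
    using dist diag that by (auto simp: distance_laplacian_def cong_iff_dvd_diff)
  moreover have "ws ! i \<in> verts K" if "i < length ws" for i
    using ws nth_mem[OF that] unfolding vertex_enumeration_def by blast
  ultimately show ?thesis
    unfolding rank_one_mod_def dim_distance_laplacian_mat
    by (intro exI[of _ "\<lambda>_. - 1"] exI[of _ "\<lambda>_. 1"])
       (simp add: distance_laplacian_mat_index[OF ws])
qed

text \<open>
  In a graph an arc is determined by its ends, and in a complete one all pairs of distinct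
  vertices occur as ends. So any bijection of the vertices lifts to the arcs.
\<close>

lemma complete_digraphs_isomorphic:
  assumes G: "complete_digraph n G" and K: "complete_digraph n K"
  shows "digraph_iso G K"
proof -
  interpret G: graph G using G by (simp add: complete_digraph_def)
  interpret K: graph K using K by (simp add: complete_digraph_def)
  obtain f where f: "bij_betw f (verts G) (verts K)"
    using G K finite_same_card_bij[OF G.finite_verts K.finite_verts]
    by (auto simp: complete_digraph_def)
  have ends: "bij_betw (arc_to_ends H) (arcs H) {(u,v). u \<in> verts H \<and> v \<in> verts H \<and> u \<noteq> v}"
    if "complete_digraph n H" for H :: "('x,'y) pre_digraph"
  proof -
    interpret H: graph H using that by (simp add: complete_digraph_def)
    have "inj_on (arc_to_ends H) (arcs H)"
      by (rule inj_onI) (rule H.no_multi_arcs)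
    moreover have "arc_to_ends H ` arcs H = {(u,v). u \<in> verts H \<and> v \<in> verts H \<and> u \<noteq> v}"
      using that by (simp add: complete_digraph_def arcs_ends_def)
    ultimately show ?thesis by (simp add: bij_betw_def)
  qed
  let ?EG = "{(u,v). u \<in> verts G \<and> v \<in> verts G \<and> u \<noteq> v}"
  let ?EK = "{(u,v). u \<in> verts K \<and> v \<in> verts K \<and> u \<noteq> v}"
  have ff: "bij_betw (map_prod f f) ?EG ?EK"
  proof -
    have inj: "inj_on f (verts G)" and im: "f ` verts G = verts K"
      using f by (auto simp: bij_betw_def)
    have "inj_on (map_prod f f) ?EG"
      using map_prod_inj_on[OF inj inj] by (rule inj_on_subset) auto
    moreover have "map_prod f f ` ?EG \<subseteq> ?EK"
      using im inj_onD[OF inj] by auto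
    moreover have "?EK \<subseteq> map_prod f f ` ?EG"
    proof clarify
      fix x y assume "x \<in> verts K" "y \<in> verts K" "x \<noteq> y"
      then obtain u v where "u \<in> verts G" "v \<in> verts G" "x = f u" "y = f v"
        using im by blast
      then show "(x, y) \<in> map_prod f f ` ?EG"
        using \<open>x \<noteq> y\<close> by (intro image_eqI[of _ _ "(u,v)"]) auto
    qed
    ultimately show ?thesis by (simp add: bij_betw_def)
  qed
  define g where "g = the_inv_into (arcs K) (arc_to_ends K) \<circ> (map_prod f f \<circ> arc_to_ends G)"
  have g: "bij_betw g (arcs G) (arcs K)"
    unfolding g_def
    using ends[OF G] ff bij_betw_the_inv_into[OF ends[OF K]] by (blast intro: bij_betw_trans)
  have g_ends: "arc_to_ends K (g a) = map_prod f f (arc_to_ends G a)" if "a \<in> arcs G" for a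
  proof -
    have "map_prod f f (arc_to_ends G a) \<in> ?EK"
      using ends[OF G] ff that by (meson bij_betwE)
    then show ?thesis
      using ends[OF K] by (simp add: g_def f_the_inv_into_f_bij_betw)
  qed
  define h where "h = \<lparr>iso_verts = f, iso_arcs = g, iso_head = head K, iso_tail = tail K\<rparr>"
  have "G.digraph_isomorphism h"
    using bij_betw_imp_inj_on[OF f] bij_betw_imp_inj_on[OF g] g_ends G.wf_digraph_axioms
    by (simp add: G.digraph_isomorphism_def h_def arc_to_ends_def)
  moreover have "K = app_iso h G"
    using bij_betw_imp_surj_on[OF f] bij_betw_imp_surj_on[OF g] by (simp add: h_def)
  ultimately show ?thesis unfolding digraph_iso_def by blast
qed

section \<open>Graphs whose distance Laplacian has vanishing minors modulo the order\<close>

text \<open>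
  A walk from \<open>u\<close> to a vertex not adjacent to \<open>u\<close> must leave the closed neighbourhood
  of \<open>u\<close>; the arc on which it does so ends at distance two from \<open>u\<close>.
\<close>

lemma (in graph) exists_induced_path:
  assumes "u \<rightarrow>\<^sup>* x" "x \<noteq> u" "\<not> u \<rightarrow> x"
  shows "\<exists>v w. u \<rightarrow> v \<and> v \<rightarrow> w \<and> u \<noteq> w \<and> \<not> u \<rightarrow> w"
  using assms
proof (induction rule: reachable_induct)
  case base
  then show ?case by simp
next
  case (step x y)
  then show ?case by metis
qed

context graph
begin

abbreviation columns_cong :: "int \<Rightarrow> 'a \<Rightarrow> 'a \<Rightarrow> bool" where
  "columns_cong m x y \<equiv>
     \<forall>r\<in>verts G. [distance_laplacian G r x = distance_laplacian G r y] (mod m)"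

definition minors_vanish_mod :: "int \<Rightarrow> bool" where
  "minors_vanish_mod m \<longleftrightarrow>
     (\<forall>r\<in>verts G. \<forall>s\<in>verts G. \<forall>x\<in>verts G. \<forall>y\<in>verts G.
        [distance_laplacian G r x * distance_laplacian G s y =
         distance_laplacian G r y * distance_laplacian G s x] (mod m))"

lemma distance_laplacian_adjacent:
  "u \<rightarrow> v \<Longrightarrow> distance_laplacian G u v = - 1"
  using adj_not_same[of u] by (auto simp: distance_laplacian_def graph_dist_adjacent)

text \<open>
  In the minor on the rows \<open>r\<close> and \<open>z\<close> and the columns \<open>x\<close> and \<open>y\<close>, both entries of row \<open>z\<close>
  are \<open>- 1\<close>.
\<close>

lemma columns_of_neighbours_cong:
  assumes minors: "minors_vanish_mod m"
    and "z \<rightarrow> x" "z \<rightarrow> y"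
  shows "columns_cong m x y"
proof
  fix r assume "r \<in> verts G"
  then have "[distance_laplacian G r x * distance_laplacian G z y =
      distance_laplacian G r y * distance_laplacian G z x] (mod m)"
    using minors adj_in_verts[OF assms(2)] adj_in_verts[OF assms(3)]
    unfolding minors_vanish_mod_def by blast
  then show "[distance_laplacian G r x = distance_laplacian G r y] (mod m)"
    using assms(2,3) by (simp add: distance_laplacian_adjacent cong_minus_minus_iff)
qed

text \<open>
  For the induction along a walk the claim is strengthened: neighbours of a vertex in one class
  lie in the other class. The classes need not be distinct.
\<close>

lemma two_column_classes:
  assumes minors: "minors_vanish_mod m"
    and uv: "u \<rightarrow> v" and "u \<rightarrow>\<^sup>* x"
  shows "columns_cong m x u \<or> columns_cong m x v"
proof -
  note nbrs = columns_of_neighbours_cong[OF minors]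
  have trans: "columns_cong m x z" if "columns_cong m x y" "columns_cong m y z" for x y z
    using that by (blast intro: cong_trans)
  have "columns_cong m x u \<and> (\<forall>y. x \<rightarrow> y \<longrightarrow> columns_cong m y v) \<or>
        columns_cong m x v \<and> (\<forall>y. x \<rightarrow> y \<longrightarrow> columns_cong m y u)"
    using \<open>u \<rightarrow>\<^sup>* x\<close>
  proof (induction rule: reachable_induct)
    case base
    have "columns_cong m y v" if "u \<rightarrow> y" for y
      using nbrs[OF that uv] .
    then show ?case by simp
  next
    case (step x y)
    have "y \<rightarrow> x"
      using sym_arcs \<open>x \<rightarrow> y\<close> by (rule arcs_ends_symmetric)
    then have nbrs_y: "columns_cong m z x" if "y \<rightarrow> z" for z
      using nbrs[OF that] by blast
    show ?case
      using step.IH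
    proof (elim disjE conjE)
      assume "columns_cong m x u" "\<forall>y. x \<rightarrow> y \<longrightarrow> columns_cong m y v"
      then show ?case
        using \<open>x \<rightarrow> y\<close> trans[OF nbrs_y] by blast
    next
      assume "columns_cong m x v" "\<forall>y. x \<rightarrow> y \<longrightarrow> columns_cong m y u"
      then show ?case
        using \<open>x \<rightarrow> y\<close> trans[OF nbrs_y] by blast
    qed
  qed
  then show ?thesis by blast
qed

text \<open>
  The modulus is the number of entries in a row, so a row with entries congruent to \<open>- 1\<close> or
  \<open>- 2\<close> and with sum \<open>0\<close> must be constant modulo the order. Row \<open>u\<close> of a path \<open>u, v, w\<close>
  between vertices at distance two is not.
\<close>

lemma minors_vanish_mod_order_imp_complete:
  assumes conn: "connected G"
    and minors: "minors_vanish_mod (int (card (verts G)))"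
  shows "complete_digraph (card (verts G)) G"
proof -
  define n where "n = card (verts G)"
  note minors = minors[folded n_def]
  have reach: "u \<rightarrow>\<^sup>* x" if "u \<in> verts G" "x \<in> verts G" for u x
    using symmetric_connected_imp_strongly_connected[OF sym_arcs conn] that
    by (auto simp: strongly_connected_def)
  have "u \<rightarrow> x" if u: "u \<in> verts G" and x: "x \<in> verts G" and "u \<noteq> x" for u x
  proof (rule ccontr)
    assume "\<not> u \<rightarrow> x"
    then obtain v w where path: "u \<rightarrow> v" "v \<rightarrow> w" "u \<noteq> w" "\<not> u \<rightarrow> w"
      using exists_induced_path[OF reach[OF u x]] \<open>u \<noteq> x\<close> by metis
    have verts: "v \<in> verts G" "w \<in> verts G"
      using path by (auto simp: adj_in_verts)
    have entry_v: "distance_laplacian G u v = - 1"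
      using path(1) by (rule distance_laplacian_adjacent)
    have entry_w: "distance_laplacian G u w = - 2"
      using graph_dist_two[OF path] path(3) by (simp add: distance_laplacian_def)
    have cols_u_w: "columns_cong (int n) u w"
      using columns_of_neighbours_cong[OF minors arcs_ends_symmetric[OF sym_arcs path(1)] path(2)] .
    have entries: "[distance_laplacian G u y = - 2] (mod int n) \<or>
        [distance_laplacian G u y = - 1] (mod int n)" if "y \<in> verts G" for y
    proof (rule disjE[OF two_column_classes[OF minors path(1) reach[OF u that]]])
      assume "columns_cong (int n) y u"
      then have "[distance_laplacian G u y = distance_laplacian G u w] (mod int n)"
        using cols_u_w u by (blast intro: cong_trans)
      then show ?thesis by (simp add: entry_w)
    next
      assume "columns_cong (int n) y v"
      then have "[distance_laplacian G u y = distance_laplacian G u v] (mod int n)"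
        using u by blast
      then show ?thesis by (simp add: entry_v)
    qed
    define A where "A = {y \<in> verts G. [distance_laplacian G u y = - 2] (mod int n)}"
    have "A \<subseteq> verts G" by (auto simp: A_def)
    \<comment> \<open>Write each entry as \<open>- 1\<close>, with a further \<open>- 1\<close> on \<open>A\<close>: the constant part
      sums to a multiple of \<open>n\<close>, which leaves the size of \<open>A\<close>.\<close>
    have "[(\<Sum>y\<in>verts G. distance_laplacian G u y) = (\<Sum>y\<in>verts G. - 1 - of_bool (y \<in> A))] (mod int n)"
      using entries by (intro cong_sum) (auto simp: A_def)
    also have "(\<Sum>y\<in>verts G. - 1 - of_bool (y \<in> A)) = - int n - int (card A)"
      using \<open>A \<subseteq> verts G\<close> by (simp add: sum_subtractf n_def Int_absorb1)
    finally have "[0 = - int n - int (card A)] (mod int n)"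
      using distance_laplacian_row_sum[OF finite_verts u] by simp
    then have "int n dvd int n + int (card A)"
      by (simp add: cong_iff_dvd_diff)
    then have "n dvd card A"
      by (simp add: dvd_add_right_iff)
    moreover have "0 < card A"
      using verts(2) entry_w finite_subset[OF \<open>A \<subseteq> verts G\<close>] by (auto simp: A_def card_gt_0_iff)
    ultimately have "n \<le> card A"
      by (rule dvd_imp_le)
    then have "A = verts G"
      using \<open>A \<subseteq> verts G\<close> card_seteq[OF finite_verts] by (simp add: n_def)
    then have "v \<in> A"
      using verts(1) by simp
    then have "[- 1 = - 2] (mod int n)"
      by (simp add: A_def entry_v)
    then have "n = 1"
      by (simp add: cong_iff_dvd_diff)
    then show False
      using u x \<open>u \<noteq> x\<close> by (auto simp: n_def card_1_singleton_iff)
  qed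
  then have "{(u,v). (u,v) \<in> verts G \<times> verts G \<and> u \<noteq> v} \<subseteq> arcs_ends G"
    by blast
  moreover have "arcs_ends G \<subseteq> {(u,v). (u,v) \<in> verts G \<times> verts G \<and> u \<noteq> v}"
    using adj_in_verts adj_not_same by blast
  ultimately show ?thesis
    unfolding complete_digraph_def using graph_axioms by blast
qed

end

theorem theorem36:
  fixes G :: "('a,'b) pre_digraph" and K :: "('c,'d) pre_digraph" and n :: nat
    and vs :: "'a list" and ws :: "'c list"
  assumes "Digraph.graph G" and "Digraph_Component.connected G"
    and "complete_digraph n K"
    and "vertex_enumeration G vs" and "vertex_enumeration K ws"
    and "same_smith_normal_form (distance_laplacian_mat G vs) (distance_laplacian_mat K ws)"
  shows "digraph_iso G K"
proof -
  interpret G: graph G by (rule assms(1))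
  let ?F = "distance_laplacian_mat G vs" and ?B = "distance_laplacian_mat K ws"
  obtain P Q where PQ: "P \<in> carrier_mat (length ws) (length ws)"
      "Q \<in> carrier_mat (length ws) (length ws)" "?F = P * ?B * Q"
    using same_smith_normal_form_imp_factorization[OF assms(6)] by auto
  have "length ws = n"
    using assms(3,5) distinct_card[of ws]
    by (simp add: complete_digraph_def vertex_enumeration_def)
  moreover have "length vs = length ws"
    using arg_cong[OF PQ(3), of dim_row] PQ(1) by simp
  moreover have "length vs = card (verts G)"
    using assms(4) distinct_card[of vs] by (simp add: vertex_enumeration_def)
  ultimately have card: "card (verts G) = n" by simp
  have rank_one: "rank_one_mod (int n) ?F"
    unfolding PQ(3) using complete_digraph_rank_one_mod[OF assms(3,5)] PQ(1,2)
    by (intro rank_one_mod_mult_right rank_one_mod_mult_left) auto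
  have "[distance_laplacian G r x * distance_laplacian G s y =
         distance_laplacian G r y * distance_laplacian G s x] (mod int n)"
    if "r \<in> verts G" "s \<in> verts G" "x \<in> verts G" "y \<in> verts G" for r s x y
  proof -
    have "\<exists>i<length vs. vs ! i = z" if "z \<in> verts G" for z
      using that assms(4) by (metis in_set_conv_nth vertex_enumeration_def)
    with that obtain i k j l where "i < length vs" "k < length vs" "j < length vs" "l < length vs"
      "vs ! i = r" "vs ! k = s" "vs ! j = x" "vs ! l = y"
      by meson
    then show ?thesis
      using rank_one_mod_minor[OF rank_one, of i k j l]
      by (auto simp: G.distance_laplacian_mat_index[OF assms(4)])
  qed
  then have "G.minors_vanish_mod (int n)"
    unfolding G.minors_vanish_mod_def by blast
  then have "complete_digraph n G"
    using G.minors_vanish_mod_order_imp_complete[OF assms(2)] card by simp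
  then show ?thesis
    using assms(3) by (rule complete_digraphs_isomorphic)
qed

end
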